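(* Let $n\ge 0$ be an integer, and let $\theta_1\ge\theta_2\ge\theta_3$ be the three remaining eigenvalues of $A(\tilde R_n)$ (as defined in the context). Let $\varphi=\frac{1+\sqrt5}{2}$. If $n>0$, then $\theta_1>\theta_2>\varphi^{-1}>-1>-\varphi>\theta_3$ and $$\mathrm{Spec}(\tilde R_n)=\begin{pmatrix}\theta_1&\theta_2&\varphi^{-1}&-1&-\varphi&\theta_3\\1&1&1&n&1&1\end{pmatrix}.$$ If $n=0$, then $\theta_3=-\varphi$, $\theta_2=\varphi^{-1}$ and $\theta_1=2$, so $$\mathrm{Spec}(\tilde R_0)=\mathrm{Spec}(C_5)=\begin{pmatrix}2&\varphi^{-1}&-\varphi\\1&2&2\end{pmatrix}.$$
   Context: For a simple graph $\Gamma$, $A(\Gamma)$ denotes its adjacency matrix. Duplicating a vertex $v'$ of a graph $G$ means adding a new vertex $v$ to $G$ together with the edge $vv'$ and all edges $vx$ with $xv'\in E(G)$. For $n\ge 0$, $\tilde R_n$ denotes the graph on $n+5$ vertices (unique up to isomorphism) obtained from the 5-cycle $C_5$ by duplicating one and the same vertex of the 5-cycle $n$ times; in particular $\tilde R_0=C_5$. The multiset of the $n+5$ eigenvalues of $A(\tilde R_n)$ contains $-1$ at least $n$ times and contains each of $-\varphi$ and $\varphi^{-1}$ at least once; $\theta_1\ge\theta_2\ge\theta_3$ are the three eigenvalues left (with multiplicity) after removing $n$ copies of $-1$, one copy of $-\varphi$ and one copy of $\varphi^{-1}$. $\mathrm{Spec}(\Gamma)$ denotes the adjacency spectrum, written as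 a two-row array: distinct eigenvalues of $A(\Gamma)$ in the first row, their multiplicities in the second row. *)

theory Defs
  imports "Jordan_Normal_Form.Char_Poly" "Graph_Theory.Pair_Digraph"
begin

text \<open>A simple graph is a \<^locale>\<open>pair_graph\<close>: an edge \<open>xy\<close> is the pair of arcs
  \<open>(x, y)\<close>, \<open>(y, x)\<close>.\<close>

text \<open>Rows and columns follow the increasing enumeration of the (finite) vertex set.\<close>

definition adjacency_matrix :: "'a :: linorder pair_pre_digraph \<Rightarrow> real mat" where
  "adjacency_matrix G =
     (let vs = sorted_list_of_set (pverts G)
      in mat (length vs) (length vs) (\<lambda>(i, j). if (vs ! i, vs ! j) \<in> parcs G then 1 else 0))"

text \<open>All eigenvalues of the symmetric matrix \<^term>\<open>adjacency_matrix G\<close> are real, so the real roots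
  of its characteristic polynomial form the complete multiset of eigenvalues.\<close>

definition adj_eigenvalues :: "'a :: linorder pair_pre_digraph \<Rightarrow> real multiset" where
  "adj_eigenvalues G = proots (char_poly (adjacency_matrix G))"

text \<open>The two rows of the spectrum: the distinct eigenvalues in decreasing order, and their
  multiplicities.\<close>

definition Spec :: "'a :: linorder pair_pre_digraph \<Rightarrow> real list \<times> nat list" where
  "Spec G =
     (let evs = rev (sorted_list_of_set {x. eigenvalue (adjacency_matrix G) x})
      in (evs, map (count (adj_eigenvalues G)) evs))"

text \<open>Duplicate the vertex \<open>v'\<close>; \<open>v\<close> is the new vertex and is meant not to lie in \<open>G\<close>.\<close>

definition duplicate_vertex :: "'a \<Rightarrow> 'a \<Rightarrow> 'a pair_pre_digraph \<Rightarrow> 'a pair_pre_digraph" where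
  "duplicate_vertex v' v G =
     \<lparr> pverts = insert v (pverts G),
       parcs = parcs G \<union> {(v, v'), (v', v)}
         \<union> {(v, x) | x. (x, v') \<in> parcs G} \<union> {(x, v) | x. (x, v') \<in> parcs G} \<rparr>"

definition C5 :: "nat pair_pre_digraph" where
  "C5 = \<lparr> pverts = {..<5},
          parcs = {(i, j). i < 5 \<and> j < 5 \<and> (j = (i + 1) mod 5 \<or> i = (j + 1) mod 5)} \<rparr>"

text \<open>The vertex set of \<open>R n\<close> is \<open>{..<n + 5}\<close>, and the vertex duplicated each time is \<open>0\<close>.\<close>

fun R :: "nat \<Rightarrow> nat pair_pre_digraph" where
  "R 0 = C5"
| "R (Suc n) = duplicate_vertex 0 (n + 5) (R n)"

lemma pverts_R: "pverts (R n) = {..<n + 5}"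
proof (induction n)
  case 0
  show ?case by (simp add: C5_def)
next
  case (Suc n)
  show ?case by (auto simp: duplicate_vertex_def Suc)
qed

lemma parcs_R_props:
  "(i, j) \<in> parcs (R n) \<Longrightarrow> i < n + 5 \<and> j < n + 5 \<and> i \<noteq> j \<and> (j, i) \<in> parcs (R n)"
proof (induction n arbitrary: i j)
  case 0
  then have ij: "i < 5" "j < 5" "j = (i + 1) mod 5 \<or> i = (j + 1) mod 5"
    by (simp_all add: C5_def)
  have "(k + 1) mod 5 \<noteq> k" if "k < 5" for k :: nat
    using that by (cases "k = 4") simp_all
  with ij have "i \<noteq> j" by metis
  with ij show ?case by (simp add: C5_def disj_commute)
next
  case (Suc n)
  have iff: "(a, b) \<in> parcs (R (Suc n)) \<longleftrightarrow> (a, b) \<in> parcs (R n)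
      \<or> a = n + 5 \<and> b = 0 \<or> a = 0 \<and> b = n + 5
      \<or> a = n + 5 \<and> (b, 0) \<in> parcs (R n) \<or> b = n + 5 \<and> (a, 0) \<in> parcs (R n)" for a b
    by (simp add: duplicate_vertex_def) blast
  from Suc.prems[unfolded iff] show ?case
    unfolding iff by (elim disjE conjE) (use Suc.IH in \<open>fastforce+\<close>)
qed

lemma pair_graph_R: "pair_graph (R n)"
proof -
  have "parcs (R n) \<subseteq> {..<n + 5} \<times> {..<n + 5}"
    using parcs_R_props by auto
  then have "finite (parcs (R n))"
    by (rule finite_subset) simp
  moreover have "symmetric (with_proj (R n))"
    unfolding symmetric_def by (rule symI) (simp add: parcs_R_props)
  ultimately show ?thesis
    by unfold_locales (auto simp: pverts_R dest: parcs_R_props)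
qed

definition golden :: real where
  "golden = (1 + sqrt 5) / 2"

text \<open>\<open>theta n 1 \<ge> theta n 2 \<ge> theta n 3\<close> are the eigenvalues of \<open>R n\<close> left, with multiplicity,
  after removing \<open>n\<close> copies of \<open>-1\<close> and one copy each of \<open>- golden\<close> and \<open>inverse golden\<close>.\<close>

definition remaining_eigenvalues :: "nat \<Rightarrow> real multiset" where
  "remaining_eigenvalues n =
     adj_eigenvalues (R n) - (replicate_mset n (-1) + {#- golden, inverse golden#})"

definition theta :: "nat \<Rightarrow> nat \<Rightarrow> real" where
  "theta n i = rev (sorted_list_of_multiset (remaining_eigenvalues n)) ! (i - 1)"

end

theory Submission
  imports Defs
begin

text \<open>
  The graph \<open>R n\<close> is a pentagon whose vertex \<open>0\<close> has been replaced by a clique \<open>K\<close> of \<open>n + 1\<close>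
  vertices, all with the same neighbours outside \<open>K\<close>. Two symmetries split off most of the spectrum.
  The difference of two unit vectors belonging to \<open>K\<close> is an eigenvector for \<open>-1\<close>, which gives \<open>n\<close>
  copies of \<open>-1\<close>; modulo these vectors, \<open>K\<close> behaves like one vertex and a 5 by 5 matrix remains.
  The reflection of the pentagon that fixes \<open>0\<close>, exchanges \<open>1\<close> with \<open>4\<close> and \<open>2\<close> with \<open>3\<close>, splits
  that matrix further: the antisymmetric vectors contribute the roots \<open>-\<phi>\<close> and \<open>1/\<phi>\<close> of
  \<open>X\<^sup>2 + X - 1\<close>, and a 3 by 3 matrix remains. Both reductions are instances of one statement about
  block matrices, \<open>char_poly_fold\<close>.

  The remaining cubic can be written as \<open>p = (X\<^sup>2 + X - 1) (X - n - 2) + 2 n\<close>. For \<open>n = 0\<close> this shows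
  its roots at once. For \<open>n > 0\<close> it shows that \<open>p\<close> has the positive value \<open>2 n\<close> at \<open>-\<phi>\<close>, at \<open>1/\<phi>\<close>
  and at \<open>n + 2\<close>, whereas \<open>p\<close> is negative at \<open>-3\<close> and at \<open>n + 1\<close>. Hence \<open>p\<close> has a root below \<open>-\<phi>\<close>,
  one between \<open>1/\<phi>\<close> and \<open>n + 1\<close>, and one between \<open>n + 1\<close> and \<open>n + 2\<close>; all six distinct eigenvalues
  are thereby put in order (\<open>cubic_factor_roots\<close>), and the multiplicities are read off from the
  complete factorization of the characteristic polynomial.
\<close>

section \<open>The graph as a blown-up pentagon\<close>

lemma small_less_cases:
  "i < 2 \<longleftrightarrow> i \<in> {0, 1}"
  "i < 3 \<longleftrightarrow> i \<in> {0, 1, 2}"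
  "i < 5 \<longleftrightarrow> i \<in> {0, 1, 2, 3, 4}" for i :: nat
  by auto

lemma parcs_C5:
  "parcs C5 = {(0, 1), (1, 0), (1, 2), (2, 1), (2, 3), (3, 2), (3, 4), (4, 3), (4, 0), (0, 4)}"
proof (intro equalityI subsetI)
  fix e assume "e \<in> parcs C5"
  then obtain i j where e: "e = (i, j)" "i < 5" "j < 5" "j = (i + 1) mod 5 \<or> i = (j + 1) mod 5"
    by (cases e) (auto simp: C5_def)
  then show "e \<in> {(0, 1), (1, 0), (1, 2), (2, 1), (2, 3), (3, 2), (3, 4), (4, 3), (4, 0), (0, 4)}"
    unfolding small_less_cases by (elim insertE emptyE) simp_all
qed (auto simp: C5_def)

lemma pentagon_loopless: "(i, i) \<notin> parcs C5"
  by (cases "i = 0") (simp_all add: parcs_C5)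

lemma pentagon_neighbours_0:
  "(i, 0) \<in> parcs C5 \<longleftrightarrow> i = 1 \<or> i = 4" "(0, i) \<in> parcs C5 \<longleftrightarrow> i = 1 \<or> i = 4"
  by (auto simp: parcs_C5)

lemma pentagon_matrix:
  assumes "i < 5" "j < 5"
  shows "[[0, 1, 0, 0, 1],
          [1, 0, 1, 0, 0],
          [0, 1, 0, 1, 0],
          [0, 0, 1, 0, 1],
          [1, 0, 0, 1, 0]] ! i ! j = (if (i, j) \<in> parcs C5 then 1 else 0 :: 'a :: zero_neq_one)"
  using assms unfolding small_less_cases parcs_C5 by (elim insertE emptyE) simp_all

text \<open>A vertex \<open>i \<ge> 5\<close> is a copy of \<open>0\<close>. Mapping every copy back to \<open>0\<close> turns adjacency into equality or
  adjacency in the pentagon, because the duplicates and their original form a clique.\<close>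
lemma parcs_R_iff:
  "(i, j) \<in> parcs (R n) \<longleftrightarrow> i < n + 5 \<and> j < n + 5 \<and> i \<noteq> j \<and>
     (let a = if i < 5 then i else 0; b = if j < 5 then j else 0
      in a = b \<or> (a, b) \<in> parcs C5)"
proof (induction n arbitrary: i j)
  case 0
  show ?case
    using parcs_R_props[of i j 0] by auto
next
  case (Suc n)
  have iff: "(i, j) \<in> parcs (R (Suc n)) \<longleftrightarrow> (i, j) \<in> parcs (R n)
      \<or> i = n + 5 \<and> j = 0 \<or> i = 0 \<and> j = n + 5
      \<or> i = n + 5 \<and> (j, 0) \<in> parcs (R n) \<or> j = n + 5 \<and> (i, 0) \<in> parcs (R n)"
    by (simp add: duplicate_vertex_def) blast
  have sym: "(a, b) \<in> parcs C5 \<longleftrightarrow> (b, a) \<in> parcs C5" for a b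
    by (auto simp: C5_def)
  show ?case
    unfolding iff Suc.IH Let_def
    by (cases "i = n + 5"; cases "j = n + 5") (auto simp: sym less_Suc_eq)
qed

text \<open>The pentagon comes first, then the \<open>n\<close> copies of \<open>0\<close>; a pentagon vertex is joined to the
  copies precisely if it is \<open>0\<close> or one of the neighbours \<open>1\<close> and \<open>4\<close> of \<open>0\<close>.\<close>
lemma adjacency_matrix_R:
  "adjacency_matrix (R n) =
     four_block_mat
       (mat 5 5 (\<lambda>(i, j).
         [[0, 1, 0, 0, 1],
          [1, 0, 1, 0, 0],
          [0, 1, 0, 1, 0],
          [0, 0, 1, 0, 1],
          [1, 0, 0, 1, 0]] ! i ! j))
       (mat 5 n (\<lambda>(i, j). if i \<in> {0, 1, 4} then 1 else 0))
       (mat n 5 (\<lambda>(i, j). if j \<in> {0, 1, 4} then 1 else 0))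
       (mat n n (\<lambda>(i, j). if i = j then 0 else 1))"
    (is "_ = ?A")
proof (rule eq_matI)
  have vs: "sorted_list_of_set (pverts (R n)) = [0..<n + 5]"
    by (simp add: pverts_R lessThan_atLeast0)
  fix i j
  assume "i < dim_row ?A" "j < dim_col ?A"
  then have ij: "i < n + 5" "j < n + 5" by simp_all
  have A: "adjacency_matrix (R n) $$ (i, j) = (if (i, j) \<in> parcs (R n) then 1 else 0)"
    using ij by (simp add: adjacency_matrix_def vs Let_def del: upt_Suc)
  show "adjacency_matrix (R n) $$ (i, j) = ?A $$ (i, j)"
    using ij unfolding A by (auto simp: parcs_R_iff pentagon_matrix pentagon_neighbours_0 pentagon_loopless)
qed (simp_all add: adjacency_matrix_def pverts_R Let_def)

section \<open>The characteristic polynomial\<close>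

lemma char_poly_four_block_mat_upper_right_zero:
  fixes B :: "'a :: idom mat"
  assumes B: "B \<in> carrier_mat m m" and L: "L \<in> carrier_mat n m" and D: "D \<in> carrier_mat n n"
  shows "char_poly (four_block_mat B (0\<^sub>m m n) L D) = char_poly B * char_poly D"
proof -
  have "char_poly_matrix (four_block_mat B (0\<^sub>m m n) L D) =
      four_block_mat (char_poly_matrix B) (0\<^sub>m m n) (map_mat (\<lambda>a. [:- a:]) L) (char_poly_matrix D)"
    using assms by (intro eq_matI) (auto simp: char_poly_matrix_def)
  then show ?thesis
    unfolding char_poly_def using assms
    by (simp add: det_four_block_mat_upper_right_zero[OF _ refl])
qed

text \<open>Laplace expansion along the first row, with the minors again in the form \<open>mat k k f\<close>: as a rewrite
  rule it evaluates determinants of small explicit matrices.\<close>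
lemma det_mat_Suc_row:
  fixes f :: "nat \<times> nat \<Rightarrow> 'a :: comm_ring_1"
  shows "det (mat (Suc k) (Suc k) f) =
    (\<Sum>j<Suc k. f (0, j) * ((-1) ^ j *
       det (mat k k (\<lambda>(a, b). f (Suc a, if b < j then b else Suc b)))))"
proof -
  have "mat_delete (mat (Suc k) (Suc k) f) 0 j =
      mat k k (\<lambda>(a, b). f (Suc a, if b < j then b else Suc b))" for j
    by (rule eq_matI) (auto simp: mat_delete_def)
  then show ?thesis
    by (subst laplace_expansion_row[where i = 0 and n = "Suc k"])
       (auto simp: cofactor_def intro!: sum.cong)
qed

text \<open>Folding the last \<open>n\<close> coordinates onto the first \<open>m\<close>: in place of the unit vectors \<open>e\<^sub>j\<close> of the last
  \<open>n\<close> coordinates take \<open>F e\<^sub>j - e\<^sub>j\<close>. The matrix \<open>P\<close> of this change of basis is its own inverse.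
  The assumption \<open>invariant\<close> says that the span of the new vectors is mapped to itself; the
  matrix acts on that span as \<open>J - L * F\<close> and on the quotient by it as \<open>C + F * L\<close>. When \<open>F\<close> sends
  each vertex of a graph to a representative of its class, the span consists of the vectors
  whose sum over each class is zero, and \<open>C + F * L\<close> is the quotient matrix.\<close>
lemma char_poly_fold:
  fixes C :: "'a :: idom mat"
  assumes C: "C \<in> carrier_mat m m" and W: "W \<in> carrier_mat m n"
    and L: "L \<in> carrier_mat n m" and J: "J \<in> carrier_mat n n" and F: "F \<in> carrier_mat m n"
    and invariant: "(C + F * L) * F = F * J + W"
  shows "char_poly (four_block_mat C W L J) = char_poly (C + F * L) * char_poly (J - L * F)"
proof -
  define A where "A = four_block_mat C W L J"
  define M where "M = four_block_mat (C + F * L) (0\<^sub>m m n) (- L) (J - L * F)"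
  define P where "P = four_block_mat (1\<^sub>m m) F (0\<^sub>m n m) (- 1\<^sub>m n)"
  have carr: "A \<in> carrier_mat (m + n) (m + n)" "M \<in> carrier_mat (m + n) (m + n)"
    "P \<in> carrier_mat (m + n) (m + n)"
    unfolding A_def M_def P_def using C W L J F by (auto intro!: four_block_carrier_mat)
  note mult_blocks = mult_four_block_mat[where ?nr1.0 = m and ?n1.0 = m and ?n2.0 = n
      and ?nr2.0 = n and ?nc1.0 = m and ?nc2.0 = n]
  have "F + - F = 0\<^sub>m m n"
    using F by (intro eq_matI) auto
  then have "P * P = four_block_mat (1\<^sub>m m) (0\<^sub>m m n) (0\<^sub>m n m) (1\<^sub>m n)"
    unfolding P_def using F by (subst mult_blocks) auto
  then have PP: "P * P = 1\<^sub>m (m + n)"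
    by simp
  \<comment> \<open>The invariance in the form needed below: the part of \<open>A (F e\<^sub>j - e\<^sub>j)\<close> in the first \<open>m\<close> coordinates
    is determined by the part in the last \<open>n\<close>.\<close>
  have upper_right: "F * (J - L * F) = C * F - W"
  proof (rule eq_matI)
    fix i j assume ij: "i < dim_row (C * F - W)" "j < dim_col (C * F - W)"
    have "C * F + F * (L * F) = F * J + W"
      using invariant C L F by (simp add: add_mult_distrib_mat[of _ m m] assoc_mult_mat[OF F L F])
    then have "(C * F + F * (L * F)) $$ (i, j) = (F * J + W) $$ (i, j)"
      by simp
    moreover have "F * (J - L * F) = F * J - F * (L * F)"
      using F J L by (simp add: mult_minus_distrib_mat[of _ m n])
    ultimately show "(F * (J - L * F)) $$ (i, j) = (C * F - W) $$ (i, j)"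
      using ij C W L J F by (simp add: algebra_simps del: index_mult_mat(1))
  qed (use C W L J F in auto)
  have "A * P = four_block_mat C (C * F - W) L (L * F - J)"
    unfolding A_def P_def using C W L J F
    by (subst mult_blocks) (auto simp: minus_add_uminus_mat)
  also have "\<dots> = P * M"
  proof -
    have "C + F * L + F * (- L) = C"
      using C L F by (intro eq_matI) (auto simp: scalar_prod_def sum_negf)
    moreover have "- (J - L * F) = L * F - J"
      using L J F by (intro eq_matI) auto
    ultimately show ?thesis
      unfolding P_def M_def using C W L J F
      by (subst mult_blocks) (auto simp: upper_right)
  qed
  finally have AP: "A * P = P * M" .
  have "A = A * (P * P)"
    by (simp only: PP right_mult_one_mat[OF carr(1)])
  also have "\<dots> = P * M * P"
    using assoc_mult_mat[OF carr(1) carr(3) carr(3)] AP by simp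
  finally have "similar_mat A M"
    using carr by (intro similar_matI[OF _ PP PP]) simp_all
  then have "char_poly A = char_poly M"
    by (rule char_poly_similar)
  also have "\<dots> = char_poly (C + F * L) * char_poly (J - L * F)"
    unfolding M_def using C W L J F
    by (intro char_poly_four_block_mat_upper_right_zero) auto
  finally show ?thesis
    by (simp only: A_def)
qed

text \<open>This is \<open>(X - n) (X\<^sup>2 - X - 1) - 2 (n + 1) (X - 1)\<close>, divided with remainder by \<open>X\<^sup>2 + X - 1\<close>: in this
  form the values at the two roots of that quadratic are visible.\<close>
definition cubic_factor :: "nat \<Rightarrow> real poly" where
  "cubic_factor n = [:-1, 1, 1:] * [:- real n - 2, 1:] + [:2 * real n:]"

lemma char_poly_mat:
  "char_poly (mat k k f) =
     det (mat k k (\<lambda>(i, j). if i = j then [:- f (i, j), 1:] else [:- f (i, j):]))"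
  unfolding char_poly_defs
  by (rule arg_cong[where f = det], rule eq_matI) auto

text \<open>The classes, in order, are the clique and the pairs \<open>{1, 4}\<close> and \<open>{2, 3}\<close>; the entry at \<open>(i, j)\<close> is
  the number of neighbours in class \<open>i\<close> of a vertex of class \<open>j\<close>.\<close>
lemma char_poly_symmetric_part:
  "char_poly (mat 3 3 (\<lambda>(i, j). [[real n, real n + 1, 0], [2, 0, 1], [0, 1, 1]] ! i ! j)) =
     cubic_factor n"
  by (simp add: char_poly_mat det_mat_Suc_row numeral_eq_Suc cubic_factor_def)

text \<open>The action on the vectors \<open>e\<^sub>2 - e\<^sub>3\<close> and \<open>e\<^sub>1 - e\<^sub>4\<close>, in this order.\<close>
lemma char_poly_antisymmetric_part:
  "char_poly (mat 2 2 (\<lambda>(i, j). [[-1, 1], [1, 0 :: real]] ! i ! j)) = [:-1, 1, 1:]"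
  by (simp add: char_poly_mat det_mat_Suc_row numeral_eq_Suc)

lemma sum_small_intervals:
  "sum f {0..<2} = f 0 + f (1 :: nat)"
  "sum f {0..<3} = f 0 + f 1 + f (2 :: nat)"
  "sum f {0..<5} = f 0 + f 1 + f 2 + f 3 + f (4 :: nat)"
  by (simp_all add: eval_nat_numeral)

text \<open>The matrix on the left is what remains of \<open>R n\<close> once the clique is treated as the single vertex
  \<open>0\<close>. It still commutes with the reflection of the pentagon, so vertex \<open>3\<close> can be folded onto \<open>2\<close> and
  vertex \<open>4\<close> onto \<open>1\<close>.\<close>
lemma char_poly_pentagon_quotient:
  "char_poly (mat 5 5 (\<lambda>(i, j).
     [[real n, real n + 1, 0, 0, real n + 1],
      [1, 0, 1, 0, 0],
      [0, 1, 0, 1, 0],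
      [0, 0, 1, 0, 1],
      [1, 0, 0, 1, 0]] ! i ! j)) = cubic_factor n * [:-1, 1, 1:]"
    (is "char_poly ?B = _")
proof -
  define C where "C = mat 3 3 (\<lambda>(i, j). [[real n, real n + 1, 0], [1, 0, 1], [0, 1, 0]] ! i ! j)"
  define W where "W = mat 3 2 (\<lambda>(i, j). [[0, real n + 1], [0, 0], [1, 0]] ! i ! j)"
  define L where "L = mat 2 3 (\<lambda>(i, j). [[0, 0, 1], [1, 0, 0 :: real]] ! i ! j)"
  define J where "J = mat 2 2 (\<lambda>(i, j). [[0, 1], [1, 0 :: real]] ! i ! j)"
  \<comment> \<open>The columns of \<open>F\<close> stand for the vertices \<open>3\<close> and \<open>4\<close>, with representatives \<open>2\<close> and \<open>1\<close>.\<close>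
  define F where "F = mat 3 2 (\<lambda>(i, j). [[0, 0], [0, 1], [1, 0 :: real]] ! i ! j)"
  define T where "T = mat 3 3 (\<lambda>(i, j). [[real n, real n + 1, 0], [2, 0, 1], [0, 1, 1]] ! i ! j)"
  define D where "D = mat 2 2 (\<lambda>(i, j). [[-1, 1], [1, 0 :: real]] ! i ! j)"
  note defs = C_def W_def L_def J_def F_def T_def D_def
  have B: "?B = four_block_mat C W L J"
    by (rule eq_matI) (auto simp: defs small_less_cases)
  have T: "C + F * L = T"
    by (rule eq_matI) (auto simp: defs small_less_cases scalar_prod_def sum_small_intervals)
  have D: "J - L * F = D"
    by (rule eq_matI) (auto simp: defs small_less_cases scalar_prod_def sum_small_intervals)
  have "T * F = F * J + W"
    by (rule eq_matI) (auto simp: defs small_less_cases scalar_prod_def sum_small_intervals)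
  then have "char_poly ?B = char_poly T * char_poly D"
    unfolding B T[symmetric] D[symmetric]
    by (intro char_poly_fold[where m = 3 and n = 2]) (simp_all add: defs T[unfolded defs])
  then show ?thesis
    by (simp only: T_def D_def char_poly_symmetric_part char_poly_antisymmetric_part)
qed

text \<open>Folding all copies of \<open>0\<close> onto \<open>0\<close> leaves minus the identity on the folded part, since the
  difference of two unit vectors of the clique is an eigenvector for \<open>-1\<close>.\<close>
lemma char_poly_adjacency_matrix_R:
  "char_poly (adjacency_matrix (R n)) = [:1, 1:] ^ n * ([:-1, 1, 1:] * cubic_factor n)"
proof -
  define C :: "real mat" where "C = mat 5 5 (\<lambda>(i, j).
     [[0, 1, 0, 0, 1],
      [1, 0, 1, 0, 0],
      [0, 1, 0, 1, 0],
      [0, 0, 1, 0, 1],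
      [1, 0, 0, 1, 0]] ! i ! j)"
  define W :: "real mat" where "W = mat 5 n (\<lambda>(i, j). if i \<in> {0, 1, 4} then 1 else 0)"
  define L :: "real mat" where "L = mat n 5 (\<lambda>(i, j). if j \<in> {0, 1, 4} then 1 else 0)"
  define J :: "real mat" where "J = mat n n (\<lambda>(i, j). if i = j then 0 else 1)"
  define F :: "real mat" where "F = mat 5 n (\<lambda>(i, j). if i = 0 then 1 else 0)"
  define B where "B = mat 5 5 (\<lambda>(i, j).
     [[real n, real n + 1, 0, 0, real n + 1],
      [1, 0, 1, 0, 0],
      [0, 1, 0, 1, 0],
      [0, 0, 1, 0, 1],
      [1, 0, 0, 1, 0]] ! i ! j)"
  note defs = C_def W_def L_def J_def F_def B_def
  have B: "C + F * L = B"
    by (rule eq_matI) (auto simp: defs small_less_cases scalar_prod_def sum_small_intervals)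
  have D: "J - L * F = - 1\<^sub>m n"
    by (rule eq_matI) (auto simp: defs scalar_prod_def sum_small_intervals)
  have "B * F = F * J + W"
  proof (rule eq_matI)
    fix i j assume "i < dim_row (F * J + W)" "j < dim_col (F * J + W)"
    then have ij: "i < 5" "j < n" by (simp_all add: defs)
    have "(\<Sum>k<n. if k = j then 0 else 1) = real n - 1"
      using ij by (simp add: sum.If_cases Int_commute of_nat_diff flip: Diff_eq)
    with ij show "(B * F) $$ (i, j) = (F * J + W) $$ (i, j)"
      by (auto simp: defs small_less_cases scalar_prod_def sum_small_intervals lessThan_atLeast0)
  qed (simp_all add: defs)
  then have "char_poly (four_block_mat C W L J) = char_poly B * char_poly (- 1\<^sub>m n)"
    unfolding B[symmetric] D[symmetric]
    by (intro char_poly_fold[where m = 5 and n = n]) (simp_all add: B, simp_all add: defs)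
  also have "char_poly (- 1\<^sub>m n :: real mat) = [:1, 1:] ^ n"
  proof -
    have "map (\<lambda>a. [:- a, 1:]) (diag_mat (- 1\<^sub>m n :: real mat)) = replicate n [:1, 1:]"
      by (intro nth_equalityI) (simp_all add: diag_mat_def)
    moreover have "upper_triangular (- 1\<^sub>m n :: real mat)"
      by auto
    ultimately show ?thesis
      by (simp add: char_poly_upper_triangular[where n = n])
  qed
  finally show ?thesis
    by (simp add: adjacency_matrix_R defs char_poly_pentagon_quotient mult_ac
          del: mult_pCons_left mult_pCons_right)
qed

section \<open>The roots of the cubic factor\<close>

lemma golden_bounds: "1 < golden" "0 < inverse golden" "inverse golden < 1"
proof -
  show "1 < golden" by (simp add: golden_def)
  then show "0 < inverse golden" "inverse golden < 1"
    by (simp_all add: inverse_less_1_iff)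
qed

lemma inverse_golden: "inverse golden = golden - 1"
proof -
  have "golden * (golden - 1) = 1"
    by (simp add: golden_def field_simps)
  then show ?thesis
    by (rule inverse_unique)
qed

lemma golden_quadratic: "[:-1, 1, 1:] = [:golden, 1:] * [:- inverse golden, 1:]"
proof -
  have "golden * (golden - 1) = 1"
    by (simp add: golden_def field_simps)
  then show ?thesis
    by (simp add: inverse_golden algebra_simps)
qed

text \<open>Intermediate values between \<open>-3\<close>, \<open>-\<phi>\<close>, \<open>1/\<phi>\<close>, \<open>n + 1\<close> and \<open>n + 2\<close>. The point \<open>n + 1\<close> separates the
  two largest roots; there the cubic takes the value \<open>- (n\<^sup>2 + n + 1)\<close>. For \<open>n = 0\<close> the values at
  \<open>-\<phi>\<close> and \<open>1/\<phi>\<close> vanish and the strict inequalities fail.\<close>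
lemma cubic_factor_roots:
  assumes "n > 0"
  obtains t1 t2 t3 where
    "t3 < - golden" "inverse golden < t2" "t2 < t1"
    "cubic_factor n = [:- t1, 1:] * ([:- t2, 1:] * [:- t3, 1:])"
proof -
  have poly_cubic: "poly (cubic_factor n) x = (x\<^sup>2 + x - 1) * (x - (real n + 2)) + 2 * real n" for x
    by (simp add: cubic_factor_def power2_eq_square algebra_simps)
  have golden_pos: "poly (cubic_factor n) (inverse golden) > 0" "poly (cubic_factor n) (- golden) > 0"
    unfolding cubic_factor_def golden_quadratic poly_add poly_mult using assms by simp_all
  have neg: "poly (cubic_factor n) (real n + 1) < 0"
  proof -
    have "poly (cubic_factor n) (real n + 1) = - (1 + real n + real n * real n)"
      unfolding poly_cubic by (simp add: power2_eq_square algebra_simps)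
    also have "\<dots> < 0"
      unfolding neg_less_0_iff_less by (intro add_pos_nonneg) simp_all
    finally show ?thesis .
  qed
  have pos: "poly (cubic_factor n) (real n + 2) > 0"
    unfolding poly_cubic using assms by simp
  have neg': "poly (cubic_factor n) (- 3) < 0"
    unfolding poly_cubic by simp
  have "golden < 3"
    by (simp add: golden_def real_less_lsqrt)
  then obtain t3 where t3: "t3 < - golden" "poly (cubic_factor n) t3 = 0"
    using poly_IVT_pos[OF _ neg' golden_pos(2)] by auto
  obtain t2 where t2: "inverse golden < t2" "t2 < real n + 1" "poly (cubic_factor n) t2 = 0"
    using poly_IVT_neg[OF _ golden_pos(1) neg] golden_bounds by force
  obtain t1 where t1: "real n + 1 < t1" "poly (cubic_factor n) t1 = 0"
    using poly_IVT_pos[OF _ neg pos] by auto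
  have "t3 < t2" "t2 < t1"
    using t1 t2 t3 golden_bounds by linarith+
  then have "cubic_factor n = [:- t1, 1:] * ([:- t2, 1:] * [:- t3, 1:])"
  proof (intro poly_eqI_degree_lead_coeff[where A = "{t1, t2, t3}" and n = 3])
    fix z assume "z \<in> {t1, t2, t3}"
    then show "poly (cubic_factor n) z = poly ([:- t1, 1:] * ([:- t2, 1:] * [:- t3, 1:])) z"
      using t1 t2 t3 unfolding poly_mult by auto
  qed (simp_all add: cubic_factor_def numeral_eq_Suc)
  with t1 t2 t3 \<open>t2 < t1\<close> show ?thesis
    by (intro that)
qed

section \<open>The spectrum\<close>

text \<open>The three roots of the cubic may coincide with other eigenvalues here, so that the case \<open>n = 0\<close>,
  where \<open>-\<phi>\<close> and \<open>1/\<phi>\<close> are double eigenvalues, is covered as well.\<close>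
lemma spectrum_from_cubic_roots:
  assumes "cubic_factor n = [:- t1, 1:] * ([:- t2, 1:] * [:- t3, 1:])"
  shows "adj_eigenvalues (R n) =
           replicate_mset n (-1) + {#- golden, inverse golden#} + {#t1, t2, t3#}"
    and "{x. eigenvalue (adjacency_matrix (R n)) x} = set_mset (adj_eigenvalues (R n))"
proof -
  let ?p = "char_poly (adjacency_matrix (R n))"
  have p: "?p = [:1, 1:] ^ n * ([:golden, 1:] * [:- inverse golden, 1:] *
      ([:- t1, 1:] * ([:- t2, 1:] * [:- t3, 1:])))"
    by (simp only: char_poly_adjacency_matrix_R golden_quadratic assms)
  have "proots ?p = repeat_mset n {#-1#} + {#- golden, inverse golden#} + {#t1, t2, t3#}"
    unfolding p
    by (simp add: proots_mult proots_power del: mult_pCons_left mult_pCons_right)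
  then show "adj_eigenvalues (R n) =
      replicate_mset n (-1) + {#- golden, inverse golden#} + {#t1, t2, t3#}"
    by (simp add: adj_eigenvalues_def)
  have "?p \<noteq> 0"
    unfolding p by (simp del: mult_pCons_left mult_pCons_right)
  moreover have "adjacency_matrix (R n) \<in> carrier_mat (n + 5) (n + 5)"
    by (simp add: adjacency_matrix_def pverts_R Let_def)
  ultimately show "{x. eigenvalue (adjacency_matrix (R n)) x} = set_mset (adj_eigenvalues (R n))"
    by (simp add: adj_eigenvalues_def eigenvalue_root_char_poly)
qed

lemma theta_from_cubic_roots:
  assumes "cubic_factor n = [:- t1, 1:] * ([:- t2, 1:] * [:- t3, 1:])" "t3 \<le> t2" "t2 \<le> t1"
  shows "theta n 1 = t1" "theta n 2 = t2" "theta n 3 = t3"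
proof -
  have "remaining_eigenvalues n = mset [t3, t2, t1]"
    unfolding remaining_eigenvalues_def spectrum_from_cubic_roots(1)[OF assms(1)] by simp
  then have "sorted_list_of_multiset (remaining_eigenvalues n) = [t3, t2, t1]"
    using assms by (simp only: sorted_list_of_multiset_mset) (simp add: sorted_sort_id)
  then show "theta n 1 = t1" "theta n 2 = t2" "theta n 3 = t3"
    by (simp_all add: theta_def)
qed

lemma Spec_R_eqI:
  assumes "sorted_wrt (>) xs" "set xs = set_mset (adj_eigenvalues (R n))"
    and "{x. eigenvalue (adjacency_matrix (R n)) x} = set_mset (adj_eigenvalues (R n))"
  shows "Spec (R n) = (xs, map (count (adj_eigenvalues (R n))) xs)"
proof -
  have "sorted_list_of_set (set (rev xs)) = rev xs"
  proof (rule sorted_list_of_set.idem_if_sorted_distinct)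
    have "sorted_wrt (<) (rev xs)"
      using assms(1) by (simp add: sorted_wrt_rev)
    then show "sorted (rev xs)" "distinct (rev xs)"
      by (simp_all only: strict_sorted_iff)
  qed
  then show ?thesis
    using assms by (simp add: Spec_def)
qed

theorem theorem4p10:
  fixes n :: nat and \<theta>\<^sub>1 \<theta>\<^sub>2 \<theta>\<^sub>3 \<phi> :: real
  assumes "\<phi> = golden"
    and "\<theta>\<^sub>1 = theta n 1" and "\<theta>\<^sub>2 = theta n 2" and "\<theta>\<^sub>3 = theta n 3"
  shows "(n > 0 \<longrightarrow>
           \<theta>\<^sub>1 > \<theta>\<^sub>2 \<and> \<theta>\<^sub>2 > inverse \<phi> \<and> inverse \<phi> > -1 \<and> -1 > -\<phi> \<and> -\<phi> > \<theta>\<^sub>3 \<and>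
           Spec (R n) = ([\<theta>\<^sub>1, \<theta>\<^sub>2, inverse \<phi>, -1, -\<phi>, \<theta>\<^sub>3],
                         [1, 1, 1, n, 1, 1])) \<and>
         (n = 0 \<longrightarrow>
           \<theta>\<^sub>3 = -\<phi> \<and> \<theta>\<^sub>2 = inverse \<phi> \<and> \<theta>\<^sub>1 = 2 \<and>
           Spec (R 0) = Spec C5 \<and>
           Spec C5 = ([2, inverse \<phi>, -\<phi>],
                      [1, 2, 2]))"
proof (intro conjI[of "n > 0 \<longrightarrow> _"] impI)
  assume n: "n > 0"
  obtain t1 t2 t3 where t: "t3 < - golden" "inverse golden < t2" "t2 < t1"
    and cubic: "cubic_factor n = [:- t1, 1:] * ([:- t2, 1:] * [:- t3, 1:])"
    using cubic_factor_roots[OF n] .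
  have order: "t3 < - golden" "- golden < -1" "-1 < inverse golden" "inverse golden < t2" "t2 < t1"
    using t golden_bounds by linarith+
  have theta: "\<theta>\<^sub>1 = t1" "\<theta>\<^sub>2 = t2" "\<theta>\<^sub>3 = t3"
    using theta_from_cubic_roots[OF cubic] order assms by simp_all
  note spectrum = spectrum_from_cubic_roots[OF cubic]
  have "Spec (R n) = ([t1, t2, inverse golden, -1, - golden, t3],
      map (count (adj_eigenvalues (R n))) [t1, t2, inverse golden, -1, - golden, t3])"
    using order n by (intro Spec_R_eqI spectrum(2)) (auto simp: spectrum(1))
  also have "map (count (adj_eigenvalues (R n))) [t1, t2, inverse golden, -1, - golden, t3] =
      [1, 1, 1, n, 1, 1]"
    using order by (simp add: spectrum(1))
  finally show "\<theta>\<^sub>1 > \<theta>\<^sub>2 \<and> \<theta>\<^sub>2 > inverse \<phi> \<and> inverse \<phi> > -1 \<and> -1 > -\<phi> \<and> -\<phi> > \<theta>\<^sub>3 \<and>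
      Spec (R n) = ([\<theta>\<^sub>1, \<theta>\<^sub>2, inverse \<phi>, -1, -\<phi>, \<theta>\<^sub>3], [1, 1, 1, n, 1, 1])"
    using order by (simp add: theta assms(1))
next
  assume n: "n = 0"
  have cubic: "cubic_factor 0 = [:- 2, 1:] * ([:- inverse golden, 1:] * [:- (- golden), 1:])"
    unfolding cubic_factor_def golden_quadratic by (simp add: algebra_simps)
  have order: "- golden < inverse golden" "inverse golden < 2"
    using golden_bounds by linarith+
  have theta: "\<theta>\<^sub>1 = 2" "\<theta>\<^sub>2 = inverse golden" "\<theta>\<^sub>3 = - golden"
    using theta_from_cubic_roots[OF cubic] order assms n by simp_all
  note spectrum = spectrum_from_cubic_roots[OF cubic]
  \<comment> \<open>\<open>R 0\<close> is kept from unfolding to \<open>C5\<close>, so that the facts about \<open>R n\<close> still match.\<close>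
  have "Spec (R 0) = ([2, inverse golden, - golden],
      map (count (adj_eigenvalues (R 0))) [2, inverse golden, - golden])"
    using order by (intro Spec_R_eqI spectrum(2)) (auto simp: spectrum(1) simp del: R.simps)
  also have "map (count (adj_eigenvalues (R 0))) [2, inverse golden, - golden] = [1, 2, 2]"
    using order by (simp add: spectrum(1) del: R.simps)
  finally show "\<theta>\<^sub>3 = -\<phi> \<and> \<theta>\<^sub>2 = inverse \<phi> \<and> \<theta>\<^sub>1 = 2 \<and> Spec (R 0) = Spec C5 \<and>
      Spec C5 = ([2, inverse \<phi>, -\<phi>], [1, 2, 2])"
    by (simp add: theta assms(1))
qed

end
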